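(* A color vector of length at least $2$ (with entries in $\{1,2,3\}$) is acceptable if and only if it is non-constant and has a non-zero sum.
   Context: Colors are elements of $\mathbb Z_2\times\mathbb Z_2$, coded $0=(0,0)$, $1=(0,1)$, $2=(1,0)$, $3=(1,1)$, and sums are taken in this group. Finite binary trees are rooted, planar; every vertex has $0$ or two (ordered) children except the root, which has degree $1$ and a single child. Leaves are numbered left to right. A color vector $\mathbf c=(c_1,\dots,c_n)$ for a tree with $n$ leaves determines the unique edge coloring in which the edge at the $i$-th leaf has color $c_i$ and the three edges at each vertex of degree $3$ sum to $0$. It is valid for the tree if this is a proper edge coloring using only colors $1,2,3$. A color vector of length $n$ is acceptable if there is a finite binary tree with $n$ leaves for which it is valid. *)

theory Defs
  imports "HOL-Library.Z2" "HOL-Library.Product_Plus"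
begin

type_synonym color = "bit \<times> bit"

text \<open>The colors coded 1, 2, 3.\<close>

definition proper_colors :: "color set" where
  "proper_colors = {(0, 1), (1, 0), (1, 1)}"

text \<open>A value of this type is the part of a finite binary tree below its root: the root of
  degree 1 is implicit, and the topmost constructor is its only child. In particular \<open>Leaf\<close> is
  the tree with one leaf and one edge.\<close>

datatype bin_tree = Leaf | Node bin_tree bin_tree

text \<open>A non-root vertex is addressed by its path from the child of the root (\<open>False\<close> = left,
  \<open>True\<close> = right), and is written \<open>Some p\<close> as a vertex; the root is the vertex \<open>None\<close>. An edge is
  named by the address of its lower endpoint, so the edge at a leaf has the leaf's address,
  and the edge at the root has the address \<open>[]\<close>.\<close>

type_synonym edge = "bool list"
type_synonym vertex = "bool list option"

fun edges :: "bin_tree \<Rightarrow> edge set" where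
  "edges Leaf = {[]}"
| "edges (Node l r) = insert [] (Cons False ` edges l \<union> Cons True ` edges r)"

definition vertices :: "bin_tree \<Rightarrow> vertex set" where
  "vertices t = insert None (Some ` edges t)"

fun leaves :: "bin_tree \<Rightarrow> edge list" where
  "leaves Leaf = [[]]"
| "leaves (Node l r) = map (Cons False) (leaves l) @ map (Cons True) (leaves r)"

definition endpoints :: "edge \<Rightarrow> vertex set" where
  "endpoints e = {if e = [] then None else Some (butlast e), Some e}"

definition incident_edges :: "bin_tree \<Rightarrow> vertex \<Rightarrow> edge set" where
  "incident_edges t v = {e \<in> edges t. v \<in> endpoints e}"

definition determined_coloring :: "bin_tree \<Rightarrow> color list \<Rightarrow> (edge \<Rightarrow> color) \<Rightarrow> bool" where
  "determined_coloring t c f \<longleftrightarrow>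
     (\<forall>i < length (leaves t). f (leaves t ! i) = c ! i) \<and>
     (\<forall>v \<in> vertices t. card (incident_edges t v) = 3 \<longrightarrow> (\<Sum>e \<in> incident_edges t v. f e) = 0)"

definition proper_edge_coloring :: "bin_tree \<Rightarrow> (edge \<Rightarrow> color) \<Rightarrow> bool" where
  "proper_edge_coloring t f \<longleftrightarrow>
     (\<forall>e \<in> edges t. \<forall>e' \<in> edges t. e \<noteq> e' \<and> endpoints e \<inter> endpoints e' \<noteq> {} \<longrightarrow> f e \<noteq> f e')"

text \<open>When the lengths agree, a determined coloring exists and its values on the edges of the tree
  are unique; see \<open>determined_coloring_exists\<close> and \<open>determined_coloring_unique\<close> below.\<close>

definition valid_for :: "color list \<Rightarrow> bin_tree \<Rightarrow> bool" where
  "valid_for c t \<longleftrightarrow> length c = length (leaves t) \<and>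
     (\<exists>f. determined_coloring t c f \<and> proper_edge_coloring t f \<and> f ` edges t \<subseteq> proper_colors)"

definition acceptable :: "color list \<Rightarrow> bool" where
  "acceptable c \<longleftrightarrow> (\<exists>t. valid_for c t)"

lemma finite_edges: "finite (edges t)"
  by (induction t) auto

lemma Nil_in_edges: "[] \<in> edges t"
  by (cases t) auto

fun inner :: "bin_tree \<Rightarrow> edge set" where
  "inner Leaf = {}"
| "inner (Node l r) = insert [] (Cons False ` inner l \<union> Cons True ` inner r)"

lemma snoc_in_edges_iff: "p @ [b] \<in> edges t \<longleftrightarrow> p \<in> inner t"
proof (induction t arbitrary: p)
  case (Node l r)
  then show ?case
    by (cases p; cases b) (auto simp: Nil_in_edges)
qed auto

lemma inner_subset_edges: "inner t \<subseteq> edges t"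
  by (induction t) auto

lemma in_endpoints_Some_iff: "Some p \<in> endpoints e \<longleftrightarrow> e = p \<or> (\<exists>b. e = p @ [b])"
  by (cases e rule: rev_cases) (auto simp: endpoints_def)

lemma incident_edges_inner:
  assumes "p \<in> inner t"
  shows "incident_edges t (Some p) = {p, p @ [False], p @ [True]}"
  using assms inner_subset_edges
  unfolding incident_edges_def
  by (auto simp: in_endpoints_Some_iff snoc_in_edges_iff)

lemma incident_edges_leaf:
  assumes "p \<in> edges t" "p \<notin> inner t"
  shows "incident_edges t (Some p) = {p}"
  using assms
  unfolding incident_edges_def
  by (auto simp: in_endpoints_Some_iff snoc_in_edges_iff)

lemma incident_edges_root: "incident_edges t None = {[]}"
  unfolding incident_edges_def endpoints_def by (auto simp: Nil_in_edges)

lemma determined_coloring_iff: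
  "determined_coloring t c f \<longleftrightarrow>
     (\<forall>i < length (leaves t). f (leaves t ! i) = c ! i) \<and>
     (\<forall>p \<in> inner t. f p + f (p @ [False]) + f (p @ [True]) = 0)"
proof -
  have "(\<forall>v \<in> vertices t. card (incident_edges t v) = 3 \<longrightarrow> (\<Sum>e \<in> incident_edges t v. f e) = 0)
    \<longleftrightarrow> (\<forall>p \<in> edges t. card (incident_edges t (Some p)) = 3 \<longrightarrow> (\<Sum>e \<in> incident_edges t (Some p). f e) = 0)"
    unfolding vertices_def by (simp add: incident_edges_root)
  also have "\<dots> \<longleftrightarrow> (\<forall>p \<in> inner t. f p + f (p @ [False]) + f (p @ [True]) = 0)"
  proof -
    have "(card (incident_edges t (Some p)) = 3 \<longrightarrow> (\<Sum>e \<in> incident_edges t (Some p). f e) = 0)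
      \<longleftrightarrow> (p \<in> inner t \<longrightarrow> f p + f (p @ [False]) + f (p @ [True]) = 0)" if "p \<in> edges t" for p
      using that by (cases "p \<in> inner t")
        (simp_all add: incident_edges_inner incident_edges_leaf add.assoc)
    then show ?thesis using inner_subset_edges by blast
  qed
  finally show ?thesis unfolding determined_coloring_def by simp
qed

lemma color_minus: "- (x :: color) = x"
  by (cases x) simp

lemma color_sum_zero_iff: "(x :: color) + y + z = 0 \<longleftrightarrow> x = y + z"
  by (metis add.assoc add_eq_0_iff2 color_minus)

lemma determined_coloring_Node:
  "determined_coloring (Node l r) c f \<longleftrightarrow>
     determined_coloring l (take (length (leaves l)) c) (\<lambda>p. f (False # p)) \<and>
     determined_coloring r (drop (length (leaves l)) c) (\<lambda>p. f (True # p)) \<and>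
     f [] = f [False] + f [True]"
  if "length c = length (leaves (Node l r))"
proof -
  let ?n = "length (leaves l)" and ?m = "length (leaves r)"
  let ?xs = "leaves (Node l r)"
  have split: "(\<forall>i < ?n + ?m. P i) \<longleftrightarrow> (\<forall>i < ?n. P i) \<and> (\<forall>i < ?m. P (?n + i))" for P
  proof safe
    fix i
    assume 1: "\<forall>i < ?n. P i" and 2: "\<forall>i < ?m. P (?n + i)" and i: "i < ?n + ?m"
    show "P i"
    proof (cases "i < ?n")
      case False
      then have "i - ?n < ?m" "i = ?n + (i - ?n)" using i by linarith+
      then show ?thesis using 2 by metis
    qed (use 1 in blast)
  qed auto
  have "(\<forall>i < length ?xs. f (?xs ! i) = c ! i) \<longleftrightarrow>
      (\<forall>i < ?n. f (False # leaves l ! i) = take ?n c ! i) \<and>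
      (\<forall>i < ?m. f (True # leaves r ! i) = drop ?n c ! i)"
    using that by (simp add: split nth_append)
  moreover have "(\<forall>p \<in> inner (Node l r). f p + f (p @ [False]) + f (p @ [True]) = 0) \<longleftrightarrow>
      f [] = f [False] + f [True] \<and>
      (\<forall>p \<in> inner l. f (False # p) + f (False # p @ [False]) + f (False # p @ [True]) = 0) \<and>
      (\<forall>p \<in> inner r. f (True # p) + f (True # p @ [False]) + f (True # p @ [True]) = 0)"
    by (simp only: inner.simps ball_simps ball_Un append_Cons append_Nil color_sum_zero_iff)
  ultimately show ?thesis
    unfolding determined_coloring_iff append_Cons by blast
qed

lemma determined_coloring_exists:
  assumes "length c = length (leaves t)"
  shows "\<exists>f. determined_coloring t c f"
  using assms
proof (induction t arbitrary: c)
  case Leaf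
  show ?case by (rule exI[of _ "\<lambda>_. c ! 0"]) (simp add: determined_coloring_iff)
next
  case (Node l r)
  obtain g h where
    g: "determined_coloring l (take (length (leaves l)) c) g" and
    h: "determined_coloring r (drop (length (leaves l)) c) h"
    using Node.IH[of "take (length (leaves l)) c"] Node.IH(2)[of "drop (length (leaves l)) c"]
      Node.prems by auto
  let ?f = "\<lambda>p. case p of [] \<Rightarrow> g [] + h [] | b # q \<Rightarrow> if b then h q else g q"
  have "determined_coloring (Node l r) c ?f"
    using g h by (simp add: determined_coloring_Node[OF Node.prems])
  then show ?case by blast
qed

lemma determined_coloring_unique:
  assumes "length c = length (leaves t)" "determined_coloring t c f" "determined_coloring t c g"
    and "e \<in> edges t"
  shows "f e = g e"
  using assms
proof (induction t arbitrary: c f g e)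
  case Leaf
  then show ?case by (simp add: determined_coloring_iff)
next
  case (Node l r)
  let ?cl = "take (length (leaves l)) c" and ?cr = "drop (length (leaves l)) c"
  have len: "length ?cl = length (leaves l)" "length ?cr = length (leaves r)"
    using Node.prems(1) by auto
  note f = Node.prems(2)[unfolded determined_coloring_Node[OF Node.prems(1)]]
  note g = Node.prems(3)[unfolded determined_coloring_Node[OF Node.prems(1)]]
  have L: "f (False # p) = g (False # p)" if "p \<in> edges l" for p
    using Node.IH(1)[OF len(1) _ _ that] f g by blast
  have R: "f (True # p) = g (True # p)" if "p \<in> edges r" for p
    using Node.IH(2)[OF len(2) _ _ that] f g by blast
  have "f [] = g []"
    using f g L[OF Nil_in_edges] R[OF Nil_in_edges] by simp
  then show ?case using Node.prems(4) L R by auto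
qed

end

theory Submission imports Defs begin

text \<open>
  The sum of the three edges at a vertex forces the edge at the root to carry the sum of the
  color vector. The sum of two non-zero colors differs from both of them, and it is non-zero
  exactly if they are distinct, so validity obeys a recursion on words alone
  (\<open>valid_for_Leaf\<close>, \<open>valid_for_Node\<close>): a single non-zero color is valid for the one-leaf
  tree, and a vector is valid for a tree with subtrees
  \<open>l\<close> and \<open>r\<close> exactly if it is a concatenation of vectors valid for \<open>l\<close> and \<open>r\<close> whose sums differ.

  Necessity. The sum is a color used at the root, hence non-zero. In a constant vector with
  value \<open>a\<close> the two parts at the topmost vertex would both have a non-zero sum in \<open>{0, a}\<close>,
  that is, the sum \<open>a\<close>, which contradicts that these sums differ.

  Sufficiency. If \<open>a\<close> and \<open>b\<close> are distinct adjacent entries, replace them by the single entry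
  \<open>a + b\<close>. This keeps the sum, and a tree for the shorter vector becomes one for the longer
  vector by growing two leaves at the merged leaf (\<open>acceptable_graft\<close>). Induction on the length
  then works provided that the merged vector is again non-constant. An unlucky choice of
  the pair can make it constant, but when the length is at least \<open>3\<close> and the sum is not \<open>0\<close>,
  there is always a good choice (\<open>nonconstant_merge\<close>).
\<close>

section \<open>Validity as a recursion on words\<close>

lemma proper_colors_iff: "x \<in> proper_colors \<longleftrightarrow> x \<noteq> 0"
proof -
  have "y = 0 \<or> y = 1" for y :: bit by (cases y) auto
  then show ?thesis by (cases x) (auto simp: proper_colors_def zero_prod_def)
qed

lemma color_add_self: "(x :: color) + x = 0"
  by (metis add.right_inverse color_minus)

lemma color_add_add_self: "(x :: color) + (x + y) = y"
  by (metis add.assoc add_0 color_add_self)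

text \<open>Two edges can only meet at an inner vertex: the root and the leaves lie on one edge each.\<close>

lemma proper_edge_coloring_iff:
  "proper_edge_coloring t f \<longleftrightarrow>
     (\<forall>p \<in> inner t. f p \<noteq> f (p @ [False]) \<and> f p \<noteq> f (p @ [True])
        \<and> f (p @ [False]) \<noteq> f (p @ [True]))"
proof -
  have "proper_edge_coloring t f \<longleftrightarrow> (\<forall>v. inj_on f (incident_edges t v))"
    unfolding proper_edge_coloring_def inj_on_def incident_edges_def by blast
  also have "\<dots> \<longleftrightarrow> (\<forall>p. inj_on f (incident_edges t (Some p)))"
    by (auto simp: incident_edges_root split_option_all)
  also have "\<dots> \<longleftrightarrow> (\<forall>p \<in> inner t. inj_on f (incident_edges t (Some p)))"
  proof -
    have "inj_on f (incident_edges t (Some p))" if "p \<notin> inner t" for p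
    proof (cases "p \<in> edges t")
      case True
      then show ?thesis using that by (simp add: incident_edges_leaf)
    next
      case False
      then have "incident_edges t (Some p) = {}"
        using that by (auto simp: incident_edges_def in_endpoints_Some_iff snoc_in_edges_iff)
      then show ?thesis by simp
    qed
    then show ?thesis by blast
  qed
  also have "\<dots> \<longleftrightarrow> (\<forall>p \<in> inner t. f p \<noteq> f (p @ [False]) \<and> f p \<noteq> f (p @ [True])
        \<and> f (p @ [False]) \<noteq> f (p @ [True]))"
    by (intro ball_cong refl) (auto simp: incident_edges_inner)
  finally show ?thesis .
qed

lemma proper_edge_coloring_Node:
  "proper_edge_coloring (Node l r) f \<longleftrightarrow>
     proper_edge_coloring l (\<lambda>p. f (False # p)) \<and> proper_edge_coloring r (\<lambda>p. f (True # p)) \<and>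
     f [] \<noteq> f [False] \<and> f [] \<noteq> f [True] \<and> f [False] \<noteq> f [True]"
  unfolding proper_edge_coloring_iff
  by (simp only: inner.simps ball_simps ball_Un append_Cons append_Nil) blast

lemma root_color_eq_sum:
  assumes "length c = length (leaves t)" "determined_coloring t c f"
  shows "f [] = sum_list c"
  using assms
proof (induction t arbitrary: c f)
  case Leaf
  then show ?case by (cases c) (auto simp: determined_coloring_iff)
next
  case (Node l r)
  let ?n = "length (leaves l)"
  note f = Node.prems(2)[unfolded determined_coloring_Node[OF Node.prems(1)]]
  have "f [False] = sum_list (take ?n c)" "f [True] = sum_list (drop ?n c)"
    using Node.IH(1)[of "take ?n c" "\<lambda>p. f (False # p)"]
      Node.IH(2)[of "drop ?n c" "\<lambda>p. f (True # p)"] f Node.prems(1) by auto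
  then show ?case using f by (metis append_take_drop_id sum_list_append)
qed

lemma valid_for_Leaf: "valid_for c Leaf \<longleftrightarrow> (\<exists>a \<in> proper_colors. c = [a])"
proof
  assume "valid_for c Leaf"
  then show "\<exists>a \<in> proper_colors. c = [a]"
    by (cases c) (auto simp: valid_for_def determined_coloring_iff)
next
  assume "\<exists>a \<in> proper_colors. c = [a]"
  then obtain a where "a \<in> proper_colors" "c = [a]" by blast
  then show "valid_for c Leaf"
    unfolding valid_for_def
    by (auto simp: determined_coloring_iff proper_edge_coloring_iff intro!: exI[of _ "\<lambda>_. a"])
qed

lemma valid_for_sum_nonzero: "valid_for c t \<Longrightarrow> sum_list c \<noteq> 0"
  unfolding valid_for_def using root_color_eq_sum Nil_in_edges
  by (metis image_subset_iff proper_colors_iff)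

lemma valid_for_NodeD:
  assumes "valid_for c (Node l r)"
  shows "\<exists>u v. c = u @ v \<and> valid_for u l \<and> valid_for v r \<and> sum_list u \<noteq> sum_list v"
proof -
  let ?u = "take (length (leaves l)) c" and ?v = "drop (length (leaves l)) c"
  obtain f where len: "length c = length (leaves (Node l r))"
    and det: "determined_coloring (Node l r) c f"
    and adj: "proper_edge_coloring (Node l r) f" and col: "f ` edges (Node l r) \<subseteq> proper_colors"
    using assms unfolding valid_for_def by blast
  note d = det[unfolded determined_coloring_Node[OF len]]
  note p = adj[unfolded proper_edge_coloring_Node]
  have lens: "length ?u = length (leaves l)" "length ?v = length (leaves r)" using len by auto
  have "f [False] = sum_list ?u" "f [True] = sum_list ?v"
    using root_color_eq_sum[OF lens(1)] root_color_eq_sum[OF lens(2)] d by blast+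
  then have "sum_list ?u \<noteq> sum_list ?v" using p by simp
  moreover have "valid_for ?u l" "valid_for ?v r"
    unfolding valid_for_def using lens d p col by (auto simp: image_subset_iff)
  ultimately show ?thesis by (metis append_take_drop_id)
qed

lemma valid_for_NodeI:
  assumes "valid_for u l" "valid_for v r" "sum_list u \<noteq> sum_list v"
  shows "valid_for (u @ v) (Node l r)"
proof -
  obtain g where g: "length u = length (leaves l)" "determined_coloring l u g"
    "proper_edge_coloring l g" "g ` edges l \<subseteq> proper_colors"
    using assms(1) unfolding valid_for_def by blast
  obtain h where h: "length v = length (leaves r)" "determined_coloring r v h"
    "proper_edge_coloring r h" "h ` edges r \<subseteq> proper_colors"
    using assms(2) unfolding valid_for_def by blast
  have ne: "g [] \<noteq> h []" "g [] \<noteq> 0" "h [] \<noteq> 0"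
    using assms g h by (simp_all add: root_color_eq_sum valid_for_sum_nonzero)
  let ?f = "\<lambda>p. case p of [] \<Rightarrow> g [] + h [] | b # q \<Rightarrow> if b then h q else g q"
  have len: "length (u @ v) = length (leaves (Node l r))" using g h by simp
  have "determined_coloring (Node l r) (u @ v) ?f"
    using g h by (simp add: determined_coloring_Node[OF len])
  moreover have "proper_edge_coloring (Node l r) ?f"
    using g h ne by (simp add: proper_edge_coloring_Node)
  moreover have "g [] + h [] \<noteq> 0"
    using ne(1) by (metis color_add_add_self add.right_neutral)
  then have "?f ` edges (Node l r) \<subseteq> proper_colors"
    using g h by (auto simp: proper_colors_iff)
  ultimately show ?thesis using len unfolding valid_for_def by blast
qed

lemma valid_for_Node:
  "valid_for c (Node l r) \<longleftrightarrow>
     (\<exists>u v. c = u @ v \<and> valid_for u l \<and> valid_for v r \<and> sum_list u \<noteq> sum_list v)"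
  using valid_for_NodeD valid_for_NodeI by blast

section \<open>Necessity\<close>

lemma sum_list_constant_color:
  fixes a :: color
  assumes "\<forall>x \<in> set c. x = a"
  shows "sum_list c = 0 \<or> sum_list c = a"
  using assms by (induction c) (auto simp: color_add_self)

lemma valid_for_nonconstant:
  assumes "valid_for c t" "length c \<ge> 2"
  shows "\<not> (\<exists>a. \<forall>x \<in> set c. x = a)"
proof
  assume "\<exists>a. \<forall>x \<in> set c. x = a"
  then obtain a where a: "\<forall>x \<in> set c. x = a" by blast
  show False
  proof (cases t)
    case Leaf
    then show ?thesis using assms by (auto simp: valid_for_Leaf)
  next
    case (Node l r)
    then obtain u v where uv: "c = u @ v" "valid_for u l" "valid_for v r"
      "sum_list u \<noteq> sum_list v"
      using assms(1) by (auto simp: valid_for_Node)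
    then have "sum_list u = a" "sum_list v = a"
      using a sum_list_constant_color[of u a] sum_list_constant_color[of v a]
      by (auto dest: valid_for_sum_nonzero)
    then show ?thesis using uv(4) by simp
  qed
qed

section \<open>Sufficiency\<close>

text \<open>A tree for \<open>w\<close> is glued onto the leaf colored by the sum of \<open>w\<close>: the edge at its root
  already has the color of that leaf.\<close>

lemma acceptable_graft:
  assumes "acceptable (u @ [sum_list w] @ v)" "acceptable w"
  shows "acceptable (u @ w @ v)"
proof -
  have "acceptable (u @ w @ v)" if "valid_for (u @ [sum_list w] @ v) t" for t
    using that
  proof (induction t arbitrary: u v)
    case Leaf
    then have "u = []" "v = []" by (auto simp: valid_for_Leaf append_eq_Cons_conv)
    then show ?case using assms(2) by simp
  next
    case (Node l r)
    then obtain y z where yz: "u @ [sum_list w] @ v = y @ z"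
      "valid_for y l" "valid_for z r" "sum_list y \<noteq> sum_list z"
      by (auto simp: valid_for_Node)
    consider y' where "y = u @ [sum_list w] @ y'" "v = y' @ z"
      | u' where "u = y @ u'" "z = u' @ [sum_list w] @ v"
      using yz(1) by (auto simp: append_eq_append_conv2 append_eq_Cons_conv Cons_eq_append_conv)
    then show ?case
    proof cases
      case 1
      then obtain t' where "valid_for (u @ w @ y') t'"
        using Node.IH(1) yz(2) unfolding acceptable_def by blast
      then have "valid_for ((u @ w @ y') @ z) (Node t' r)"
        using yz 1 by (intro valid_for_NodeI) auto
      then show ?thesis using 1 unfolding acceptable_def by auto
    next
      case 2
      then obtain t' where "valid_for (u' @ w @ v) t'"
        using Node.IH(2) yz(3) unfolding acceptable_def by blast
      then have "valid_for (y @ (u' @ w @ v)) (Node l t')"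
        using yz 2 by (intro valid_for_NodeI) auto
      then show ?thesis using 2 unfolding acceptable_def by auto
    qed
  qed
  then show ?thesis using assms(1) unfolding acceptable_def by blast
qed

lemma acceptable_pair:
  assumes "a \<noteq> 0" "b \<noteq> 0" "a \<noteq> b"
  shows "acceptable [a, b]"
proof -
  have "valid_for ([a] @ [b]) (Node Leaf Leaf)"
    using assms by (intro valid_for_NodeI) (auto simp: valid_for_Leaf proper_colors_iff)
  then show ?thesis unfolding acceptable_def by auto
qed

lemma nonconstant_adjacent_distinct:
  assumes "\<not> (\<exists>a. \<forall>x \<in> set c. x = a)"
  shows "\<exists>u a b v. c = u @ [a, b] @ v \<and> a \<noteq> b"
proof (rule ccontr)
  assume no: "\<not> ?thesis"
  have "\<exists>a. \<forall>x \<in> set c. x = a"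
    using no
  proof (induction c)
    case (Cons a c)
    have "\<not> (\<exists>u x y v. c = u @ [x, y] @ v \<and> x \<noteq> y)"
      using Cons.prems by (metis append_Cons)
    then have const: "\<exists>d. \<forall>x \<in> set c. x = d" by (rule Cons.IH)
    show ?case
    proof (cases c)
      case (Cons b c')
      then have "a = b" using Cons.prems by (metis append_Cons append_Nil)
      then show ?thesis using const Cons by auto
    qed simp
  qed simp
  then show False using assms by blast
qed

text \<open>If merging \<open>a, b\<close> into \<open>x = a + b\<close> leaves only the color \<open>x\<close>, then the vector is
  \<open>x\<dots>x a b x\<dots>x\<close>. Merging \<open>a\<close> or \<open>b\<close> with a neighboring \<open>x\<close> instead yields \<open>b b\<close> or \<open>a a\<close>
  among the remaining entries \<open>x\<close>. Such an entry does remain, because otherwise the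
  vector would be \<open>x a b\<close> or \<open>a b x\<close>, which has sum \<open>0\<close>.\<close>

lemma nonconstant_merge:
  fixes c :: "color list"
  assumes "length c \<ge> 3" "0 \<notin> set c" "\<not> (\<exists>a. \<forall>x \<in> set c. x = a)" "sum_list c \<noteq> 0"
  shows "\<exists>u a b v. c = u @ [a, b] @ v \<and> a \<noteq> b \<and> \<not> (\<exists>d. \<forall>x \<in> set (u @ [a + b] @ v). x = d)"
proof -
  obtain u a b v where c: "c = u @ [a, b] @ v" "a \<noteq> b"
    using nonconstant_adjacent_distinct[OF assms(3)] by blast
  have nz: "a \<noteq> 0" "b \<noteq> 0" using c assms(2) by auto
  define x where "x = a + b"
  have sums: "x + a = b" "b + x = a"
    unfolding x_def by (metis add.commute color_add_add_self)+
  have ne: "x \<noteq> a" "x \<noteq> b"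
    using nz unfolding x_def by auto
  show ?thesis
  proof (cases "\<exists>d. \<forall>y \<in> set (u @ [x] @ v). y = d")
    case False
    then show ?thesis using c unfolding x_def by blast
  next
    case True
    then have const: "set u \<subseteq> {x}" "set v \<subseteq> {x}" by auto
    consider "u \<noteq> []" | "v \<noteq> []" using assms(1) c by fastforce
    then show ?thesis
    proof cases
      case 1
      then obtain u' where u: "u = u' @ [x]"
        using const(1) by (cases u rule: rev_cases) auto
      have "u' \<noteq> [] \<or> v \<noteq> []"
      proof (rule ccontr)
        assume "\<not> ?thesis"
        then have "sum_list c = x + (a + b)" using c u by (simp add: add.assoc)
        then show False using assms(4) by (simp add: x_def color_add_self)
      qed
      then have "x \<in> set (u' @ v)" using const u by (cases u'; cases v) auto
      then have "\<not> (\<exists>d. \<forall>y \<in> set (u' @ [x + a] @ b # v). y = d)"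
        using ne sums by auto
      moreover have "c = u' @ [x, a] @ b # v" using c u by simp
      ultimately show ?thesis using ne by blast
    next
      case 2
      then obtain v' where v: "v = x # v'"
        using const(2) by (cases v) auto
      have "u \<noteq> [] \<or> v' \<noteq> []"
      proof (rule ccontr)
        assume "\<not> ?thesis"
        then have "sum_list c = (a + b) + x" using c v by (simp add: add.assoc)
        then show False using assms(4) by (simp add: x_def color_add_self)
      qed
      then have "x \<in> set (u @ v')" using const v by (cases u; cases v') auto
      then have "\<not> (\<exists>d. \<forall>y \<in> set ((u @ [a]) @ [b + x] @ v'). y = d)"
        using ne sums by auto
      moreover have "c = (u @ [a]) @ [b, x] @ v'" using c v by simp
      ultimately show ?thesis using ne by blast
    qed
  qed
qed

lemma nonconstant_imp_acceptable:
  fixes c :: "color list"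
  assumes "0 \<notin> set c" "\<not> (\<exists>a. \<forall>x \<in> set c. x = a)" "sum_list c \<noteq> 0"
  shows "acceptable c"
  using assms
proof (induction "length c" arbitrary: c rule: less_induct)
  case less
  show ?case
  proof (cases "length c \<ge> 3")
    case True
    obtain u a b v where c: "c = u @ [a, b] @ v" "a \<noteq> b"
      and nc: "\<not> (\<exists>d. \<forall>x \<in> set (u @ [a + b] @ v). x = d)"
      using nonconstant_merge[OF True less.prems] by blast
    have "a + b \<noteq> 0" using c(2) by (metis color_add_add_self add.right_neutral)
    then have "acceptable (u @ [a + b] @ v)"
      using less.prems c nc by (intro less.hyps) (auto simp: add.assoc)
    moreover have "acceptable [a, b]"
      using less.prems(1) c by (intro acceptable_pair) auto
    ultimately show ?thesis using acceptable_graft[of u "[a, b]" v] c by simp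
  next
    case False
    obtain u a b v where c: "c = u @ [a, b] @ v" "a \<noteq> b"
      using nonconstant_adjacent_distinct[OF less.prems(2)] by blast
    then have "c = [a, b]" using False by (cases u; cases v) auto
    then show ?thesis using acceptable_pair c(2) less.prems(1) by auto
  qed
qed

theorem proposition12p6:
  fixes c :: "color list"
  assumes "length c \<ge> 2"
    and "set c \<subseteq> proper_colors"
  shows "acceptable c \<longleftrightarrow> \<not> (\<exists>a. \<forall>x \<in> set c. x = a) \<and> sum_list c \<noteq> 0"
proof
  assume "acceptable c"
  then obtain t where "valid_for c t" unfolding acceptable_def by blast
  then show "\<not> (\<exists>a. \<forall>x \<in> set c. x = a) \<and> sum_list c \<noteq> 0"
    using valid_for_nonconstant valid_for_sum_nonzero assms(1) by blast
next
  assume "\<not> (\<exists>a. \<forall>x \<in> set c. x = a) \<and> sum_list c \<noteq> 0"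
  moreover have "0 \<notin> set c" using assms(2) proper_colors_iff by blast
  ultimately show "acceptable c" using nonconstant_imp_acceptable by blast
qed

end
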